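(* Let $M$ be a smooth manifold, $E$ an almost product structure on $M$, $\nabla$ a linear connection on $M$ and $\nabla^{(E)}$ the product conjugate connection of $\nabla$, i.e. $\nabla^{(E)}_XY=E(\nabla_X(EY))$. Then: (1) $\nabla^{(E)}E=-\nabla E$; consequently $\nabla E=0$ if and only if $\nabla^{(E)}E=0$. (2) $\nabla$ and $\nabla^{(E)}$ are in duality: $(\nabla^{(E)})^{(E)}=\nabla$. (3) $T_{\nabla^{(E)}}=T_{\nabla}+E(d^{\nabla}E)$, where $(d^{\nabla}E)(X,Y):=(\nabla_XE)Y-(\nabla_YE)X$; consequently, if $\nabla E=0$ then $\nabla$ and $\nabla^{(E)}$ have the same torsion. (4) $R_{\nabla^{(E)}}(X,Y,Z)=E(R_{\nabla}(X,Y,EZ))$ for all vector fields $X,Y,Z$; consequently $\nabla$ is flat if and only if $\nabla^{(E)}$ is flat. (5) Assume that $(M,g,E)$ is an almost product Riemannian manifold, i.e. $g$ is a Riemannian metric with $g(EX,EY)=g(X,Y)$ for all vector fields $X,Y$. Then $(\nabla^{(E)}_Xg)(EY,EZ)=(\nabla_Xg)(Y,Z)$ for all vector fields $X,Y,Z$; consequently $\nabla$ is a $g$-metric connection (i.e. $\nabla g=0$) if and only if $\nabla^{(E)}$ is a $g$-metric connection.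
   Context: An almost product structure on $M$ is an endomorphism $E$ of the tangent bundle $TM$ (a $(1,1)$-tensor field) with $E^2=I$, the identity. For a linear connection $\nabla$ on $TM$, $(\nabla_XE)Y=\nabla_X(EY)-E(\nabla_XY)$. The torsion is $T_\nabla(X,Y)=\nabla_XY-\nabla_YX-[X,Y]$ and the curvature is $R_\nabla(X,Y,Z)=\nabla_X\nabla_YZ-\nabla_Y\nabla_XZ-\nabla_{[X,Y]}Z$; $\nabla$ is flat if $R_\nabla=0$. The product conjugate connection of $\nabla$ is the linear connection $\nabla^{(E)}_XY:=E(\nabla_X(EY))=\nabla_XY+E((\nabla_XE)Y)$. *)

theory Defs
  imports "HOL-Analysis.Analysis" "HOL-Library.Function_Algebras"
begin

section \<open>Smooth manifolds\<close>

text \<open>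
  \<open>C\<^sup>k\<close> maps on an open set \<open>S\<close> of a finite-dimensional normed space, by recursion on \<open>k\<close>:
  all directional derivatives exist and are again \<open>C\<^sup>k\<^sup>-\<^sup>1\<close>.
\<close>

primrec higher_differentiable_on ::
  "'a::real_normed_vector set \<Rightarrow> ('a \<Rightarrow> 'b::real_normed_vector) \<Rightarrow> nat \<Rightarrow> bool" where
  "higher_differentiable_on S f 0 \<longleftrightarrow> continuous_on S f"
| "higher_differentiable_on S f (Suc k) \<longleftrightarrow>
     (\<forall>x\<in>S. f differentiable (at x)) \<and>
     (\<forall>v. higher_differentiable_on S (\<lambda>x. frechet_derivative f (at x) v) k)"

definition smooth_on :: "'a::real_normed_vector set \<Rightarrow> ('a \<Rightarrow> 'b::real_normed_vector) \<Rightarrow> bool" where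
  "smooth_on S f \<longleftrightarrow> (\<forall>k. higher_differentiable_on S f k)"

text \<open>
  The points of the manifold are the elements of the type \<open>'m\<close>, whose classes make it Hausdorff
  and second countable. A chart is a pair of a domain and a coordinate map into the model
  space \<open>'e\<close>. The model space is an arbitrary finite-dimensional real normed space rather than
  a \<open>euclidean_space\<close> because the latter class excludes dimension 0.
\<close>

type_synonym ('m, 'e) chart = "'m set \<times> ('m \<Rightarrow> 'e)"

definition is_chart ::
  "('m::topological_space, 'e::real_normed_vector) chart \<Rightarrow> bool" where
  "is_chart c \<longleftrightarrow> (case c of (U, \<phi>) \<Rightarrow>
     open U \<and> open (\<phi> ` U) \<and> (\<exists>\<psi>. homeomorphism U (\<phi> ` U) \<phi> \<psi>))"

definition smooth_manifold ::
  "('m::{t2_space, second_countable_topology}, 'e::real_normed_vector) chart set \<Rightarrow> bool" where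
  "smooth_manifold A \<longleftrightarrow>
     (\<exists>B::'e set. finite B \<and> span B = UNIV) \<and>
     (\<forall>c\<in>A. is_chart c) \<and>
     (\<Union>(U, \<phi>)\<in>A. U) = UNIV \<and>
     (\<forall>(U, \<phi>)\<in>A. \<forall>(V, \<theta>)\<in>A. smooth_on (\<phi> ` (U \<inter> V)) (\<theta> \<circ> inv_into U \<phi>))"

definition smooth_functions ::
  "('m::{t2_space, second_countable_topology}, 'e::real_normed_vector) chart set \<Rightarrow> ('m \<Rightarrow> real) set" where
  "smooth_functions A = {f. \<forall>(U, \<phi>)\<in>A. smooth_on (\<phi> ` U) (f \<circ> inv_into U \<phi>)}"


section \<open>Tangent vectors, vector fields, tensor fields\<close>

text \<open>
  Tangent vectors are derivations of the algebra of smooth functions at a point. They are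
  normalised to vanish on non-smooth functions, so that equality of tangent vectors is equality
  in HOL. Addition, subtraction, negation and zero of tangent vectors and of vector fields are the
  pointwise operations on functions.
\<close>

type_synonym 'm tangent = "('m \<Rightarrow> real) \<Rightarrow> real"

type_synonym 'm field = "'m \<Rightarrow> 'm tangent"

definition tangent_space ::
  "('m::{t2_space, second_countable_topology}, 'e::real_normed_vector) chart set \<Rightarrow> 'm \<Rightarrow> 'm tangent set" where
  "tangent_space A p = {v.
     (\<forall>f\<in>smooth_functions A. \<forall>h\<in>smooth_functions A. v (\<lambda>q. f q + h q) = v f + v h) \<and>
     (\<forall>c. \<forall>f\<in>smooth_functions A. v (\<lambda>q. c * f q) = c * v f) \<and>
     (\<forall>f\<in>smooth_functions A. \<forall>h\<in>smooth_functions A.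
        v (\<lambda>q. f q * h q) = f p * v h + h p * v f) \<and>
     (\<forall>f. f \<notin> smooth_functions A \<longrightarrow> v f = 0)}"

definition tscale :: "real \<Rightarrow> 'm tangent \<Rightarrow> 'm tangent" where
  "tscale c v = (\<lambda>f. c * v f)"

definition fscale :: "('m \<Rightarrow> real) \<Rightarrow> 'm field \<Rightarrow> 'm field" where
  "fscale f X = (\<lambda>p. tscale (f p) (X p))"

definition field_deriv :: "'m field \<Rightarrow> ('m \<Rightarrow> real) \<Rightarrow> ('m \<Rightarrow> real)" where
  "field_deriv X f = (\<lambda>p. X p f)"

definition vector_fields ::
  "('m::{t2_space, second_countable_topology}, 'e::real_normed_vector) chart set \<Rightarrow> 'm field set" where
  "vector_fields A = {X.
     (\<forall>p. X p \<in> tangent_space A p) \<and>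
     (\<forall>f\<in>smooth_functions A. field_deriv X f \<in> smooth_functions A)}"

definition lie_bracket :: "'m field \<Rightarrow> 'm field \<Rightarrow> 'm field" where
  "lie_bracket X Y = (\<lambda>p f. X p (field_deriv Y f) - Y p (field_deriv X f))"

text \<open>
  A \<open>(1,1)\<close>-tensor field is a family of endomorphisms of the tangent spaces which is smooth, i.e.
  maps smooth vector fields to smooth vector fields.
\<close>

definition endo_app :: "('m \<Rightarrow> 'm tangent \<Rightarrow> 'm tangent) \<Rightarrow> 'm field \<Rightarrow> 'm field" where
  "endo_app E X = (\<lambda>p. E p (X p))"

definition tangent_endomorphism ::
  "('m::{t2_space, second_countable_topology}, 'e::real_normed_vector) chart set \<Rightarrow>
   ('m \<Rightarrow> 'm tangent \<Rightarrow> 'm tangent) \<Rightarrow> bool" where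
  "tangent_endomorphism A E \<longleftrightarrow>
     (\<forall>p. \<forall>v\<in>tangent_space A p. E p v \<in> tangent_space A p) \<and>
     (\<forall>p. \<forall>v\<in>tangent_space A p. \<forall>w\<in>tangent_space A p. E p (v + w) = E p v + E p w) \<and>
     (\<forall>p c. \<forall>v\<in>tangent_space A p. E p (tscale c v) = tscale c (E p v)) \<and>
     (\<forall>X\<in>vector_fields A. endo_app E X \<in> vector_fields A)"

definition almost_product ::
  "('m::{t2_space, second_countable_topology}, 'e::real_normed_vector) chart set \<Rightarrow>
   ('m \<Rightarrow> 'm tangent \<Rightarrow> 'm tangent) \<Rightarrow> bool" where
  "almost_product A E \<longleftrightarrow>
     tangent_endomorphism A E \<and> (\<forall>p. \<forall>v\<in>tangent_space A p. E p (E p v) = v)"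

definition metric_app ::
  "('m \<Rightarrow> 'm tangent \<Rightarrow> 'm tangent \<Rightarrow> real) \<Rightarrow> 'm field \<Rightarrow> 'm field \<Rightarrow> ('m \<Rightarrow> real)" where
  "metric_app g X Y = (\<lambda>p. g p (X p) (Y p))"

definition riemannian_metric ::
  "('m::{t2_space, second_countable_topology}, 'e::real_normed_vector) chart set \<Rightarrow>
   ('m \<Rightarrow> 'm tangent \<Rightarrow> 'm tangent \<Rightarrow> real) \<Rightarrow> bool" where
  "riemannian_metric A g \<longleftrightarrow>
     (\<forall>p. \<forall>u\<in>tangent_space A p. \<forall>v\<in>tangent_space A p. \<forall>w\<in>tangent_space A p.
        g p (u + v) w = g p u w + g p v w) \<and>
     (\<forall>p c. \<forall>v\<in>tangent_space A p. \<forall>w\<in>tangent_space A p. g p (tscale c v) w = c * g p v w) \<and>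
     (\<forall>p. \<forall>v\<in>tangent_space A p. \<forall>w\<in>tangent_space A p. g p v w = g p w v) \<and>
     (\<forall>p. \<forall>v\<in>tangent_space A p. v \<noteq> 0 \<longrightarrow> g p v v > 0) \<and>
     (\<forall>X\<in>vector_fields A. \<forall>Y\<in>vector_fields A. metric_app g X Y \<in> smooth_functions A)"

definition almost_product_riemannian ::
  "('m::{t2_space, second_countable_topology}, 'e::real_normed_vector) chart set \<Rightarrow>
   ('m \<Rightarrow> 'm tangent \<Rightarrow> 'm tangent \<Rightarrow> real) \<Rightarrow> ('m \<Rightarrow> 'm tangent \<Rightarrow> 'm tangent) \<Rightarrow> bool" where
  "almost_product_riemannian A g E \<longleftrightarrow>
     almost_product A E \<and> riemannian_metric A g \<and>
     (\<forall>X\<in>vector_fields A. \<forall>Y\<in>vector_fields A.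
        metric_app g (endo_app E X) (endo_app E Y) = metric_app g X Y)"


section \<open>Linear connections\<close>

text \<open>
  \<open>nabla X Y\<close> is \<open>\<nabla>\<^sub>X Y\<close>; its values are unconstrained unless both arguments are smooth vector
  fields. Homogeneity in \<open>Y\<close> over \<open>\<real>\<close> is the Leibniz rule for constant functions.
\<close>

type_synonym 'm connection = "'m field \<Rightarrow> 'm field \<Rightarrow> 'm field"

definition linear_connection ::
  "('m::{t2_space, second_countable_topology}, 'e::real_normed_vector) chart set \<Rightarrow> 'm connection \<Rightarrow> bool" where
  "linear_connection A nabla \<longleftrightarrow>
     (\<forall>X\<in>vector_fields A. \<forall>Y\<in>vector_fields A. nabla X Y \<in> vector_fields A) \<and>
     (\<forall>X\<in>vector_fields A. \<forall>X'\<in>vector_fields A. \<forall>Y\<in>vector_fields A.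
        nabla (X + X') Y = nabla X Y + nabla X' Y) \<and>
     (\<forall>f\<in>smooth_functions A. \<forall>X\<in>vector_fields A. \<forall>Y\<in>vector_fields A.
        nabla (fscale f X) Y = fscale f (nabla X Y)) \<and>
     (\<forall>X\<in>vector_fields A. \<forall>Y\<in>vector_fields A. \<forall>Y'\<in>vector_fields A.
        nabla X (Y + Y') = nabla X Y + nabla X Y') \<and>
     (\<forall>f\<in>smooth_functions A. \<forall>X\<in>vector_fields A. \<forall>Y\<in>vector_fields A.
        nabla X (fscale f Y) = fscale (field_deriv X f) Y + fscale f (nabla X Y))"

definition product_conjugate ::
  "('m \<Rightarrow> 'm tangent \<Rightarrow> 'm tangent) \<Rightarrow> 'm connection \<Rightarrow> 'm connection" where
  "product_conjugate E nabla X Y = endo_app E (nabla X (endo_app E Y))"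

definition torsion :: "'m connection \<Rightarrow> 'm field \<Rightarrow> 'm field \<Rightarrow> 'm field" where
  "torsion nabla X Y = nabla X Y - nabla Y X - lie_bracket X Y"

definition curvature :: "'m connection \<Rightarrow> 'm field \<Rightarrow> 'm field \<Rightarrow> 'm field \<Rightarrow> 'm field" where
  "curvature nabla X Y Z =
     nabla X (nabla Y Z) - nabla Y (nabla X Z) - nabla (lie_bracket X Y) Z"

definition flat ::
  "('m::{t2_space, second_countable_topology}, 'e::real_normed_vector) chart set \<Rightarrow> 'm connection \<Rightarrow> bool" where
  "flat A nabla \<longleftrightarrow>
     (\<forall>X\<in>vector_fields A. \<forall>Y\<in>vector_fields A. \<forall>Z\<in>vector_fields A. curvature nabla X Y Z = 0)"

text \<open>\<open>(\<nabla>\<^sub>X E) Y\<close>\<close>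

definition cov_deriv_endo ::
  "'m connection \<Rightarrow> ('m \<Rightarrow> 'm tangent \<Rightarrow> 'm tangent) \<Rightarrow> 'm field \<Rightarrow> 'm field \<Rightarrow> 'm field" where
  "cov_deriv_endo nabla E X Y = nabla X (endo_app E Y) - endo_app E (nabla X Y)"

definition parallel_endo ::
  "('m::{t2_space, second_countable_topology}, 'e::real_normed_vector) chart set \<Rightarrow>
   'm connection \<Rightarrow> ('m \<Rightarrow> 'm tangent \<Rightarrow> 'm tangent) \<Rightarrow> bool" where
  "parallel_endo A nabla E \<longleftrightarrow>
     (\<forall>X\<in>vector_fields A. \<forall>Y\<in>vector_fields A. cov_deriv_endo nabla E X Y = 0)"

text \<open>\<open>(d\<^sup>\<nabla> E)(X, Y)\<close>\<close>

definition ext_cov_deriv_endo ::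
  "'m connection \<Rightarrow> ('m \<Rightarrow> 'm tangent \<Rightarrow> 'm tangent) \<Rightarrow> 'm field \<Rightarrow> 'm field \<Rightarrow> 'm field" where
  "ext_cov_deriv_endo nabla E X Y = cov_deriv_endo nabla E X Y - cov_deriv_endo nabla E Y X"

text \<open>\<open>(\<nabla>\<^sub>X g)(Y, Z)\<close>\<close>

definition cov_deriv_metric ::
  "'m connection \<Rightarrow> ('m \<Rightarrow> 'm tangent \<Rightarrow> 'm tangent \<Rightarrow> real) \<Rightarrow>
   'm field \<Rightarrow> 'm field \<Rightarrow> 'm field \<Rightarrow> ('m \<Rightarrow> real)" where
  "cov_deriv_metric nabla g X Y Z =
     field_deriv X (metric_app g Y Z) - metric_app g (nabla X Y) Z - metric_app g Y (nabla X Z)"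

definition metric_connection ::
  "('m::{t2_space, second_countable_topology}, 'e::real_normed_vector) chart set \<Rightarrow>
   'm connection \<Rightarrow> ('m \<Rightarrow> 'm tangent \<Rightarrow> 'm tangent \<Rightarrow> real) \<Rightarrow> bool" where
  "metric_connection A nabla g \<longleftrightarrow>
     (\<forall>X\<in>vector_fields A. \<forall>Y\<in>vector_fields A. \<forall>Z\<in>vector_fields A.
        cov_deriv_metric nabla g X Y Z = 0)"

lemma linear_connection_product_conjugate:
  assumes E: "almost_product A E" and nabla: "linear_connection A nabla"
  shows "linear_connection A (product_conjugate E nabla)"
proof -
  have T: "X p \<in> tangent_space A p" if "X \<in> vector_fields A" for X p
    using that by (simp add: vector_fields_def)
  have sc: "tscale c v \<in> tangent_space A p" if "v \<in> tangent_space A p" for c v p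
    using that by (simp add: tangent_space_def tscale_def algebra_simps)
  have E_clos: "endo_app E X \<in> vector_fields A" if "X \<in> vector_fields A" for X
    using that E by (simp add: almost_product_def tangent_endomorphism_def)
  have E_add': "E p (v + w) = E p v + E p w" if "v \<in> tangent_space A p" "w \<in> tangent_space A p" for p v w
    using that E by (simp add: almost_product_def tangent_endomorphism_def)
  have E_sc': "E p (tscale c v) = tscale c (E p v)" if "v \<in> tangent_space A p" for p c v
    using that E by (simp add: almost_product_def tangent_endomorphism_def)
  have E_E: "E p (E p v) = v" if "v \<in> tangent_space A p" for p v
    using that E by (simp add: almost_product_def)
  have E_add: "endo_app E (X + Y) = endo_app E X + endo_app E Y"
    if "X \<in> vector_fields A" "Y \<in> vector_fields A" for X Y
    using that by (simp add: endo_app_def fun_eq_iff E_add' T)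
  have E_sc: "endo_app E (fscale f X) = fscale f (endo_app E X)" if "X \<in> vector_fields A" for f X
    using that by (simp add: endo_app_def fscale_def fun_eq_iff E_sc' T)
  have E_leib: "endo_app E (fscale f (endo_app E Y) + fscale h Z) = fscale f Y + fscale h (endo_app E Z)"
    if "Y \<in> vector_fields A" "Z \<in> vector_fields A" for f h Y Z
    using that E_clos[OF that(1)] T[OF E_clos[OF that(1)]]
    by (simp add: endo_app_def fscale_def fun_eq_iff E_sc' E_add' E_E T sc)
  show ?thesis
    using nabla unfolding linear_connection_def product_conjugate_def
    by (simp add: E_clos E_add E_sc E_leib)
qed

end

theory Submission
  imports Defs
begin

text \<open>
  Every identity is pure algebra from \<open>E\<^sup>2 = I\<close> and the additivity of \<open>E\<close> on tangent spaces. The one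
  analytic input is in (4): \<open>E\<^sup>2 = I\<close> may be cancelled in \<open>\<nabla>\<^bsub>[X,Y]\<^esub>(EZ)\<close> only if that is a vector field,
  so \<open>[X, Y]\<close> has to be one; this uses that the smooth functions form an algebra.
\<close>

section \<open>The algebra of smooth functions\<close>

text \<open>A Frechet derivative on an open set depends only on nearby values. This is needed
  because the sum and product rules give the derivative only at points of \<open>S\<close>, while
  \<open>frechet_derivative\<close> is a total function.\<close>

lemma higher_differentiable_on_cong:
  assumes "open S" and "\<And>x. x \<in> S \<Longrightarrow> f x = g x"
    and "higher_differentiable_on S f k"
  shows "higher_differentiable_on S g k"
  using assms(2,3)
proof (induction k arbitrary: f g)
  case 0
  then show ?case using continuous_on_cong[OF refl, of S f g] by simp
next
  case (Suc k)
  have g: "(g has_derivative frechet_derivative f (at x)) (at x)" if "x \<in> S" for x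
  proof (rule has_derivative_transform_within_open)
    show "(f has_derivative frechet_derivative f (at x)) (at x)"
      using Suc.prems(2) that by (simp flip: frechet_derivative_works)
  qed (use assms(1) that Suc.prems(1) in auto)
  have "higher_differentiable_on S (\<lambda>x. frechet_derivative g (at x) v) k" for v
  proof (rule Suc.IH)
    show "higher_differentiable_on S (\<lambda>x. frechet_derivative f (at x) v) k"
      using Suc.prems(2) by simp
  qed (simp add: frechet_derivative_at[OF g])
  with g show ?case by (auto simp: differentiable_def)
qed

text \<open>The definition does not build order \<open>k\<close> into order \<open>Suc k\<close>.
  Differentiability gives continuity at the bottom, and the induction then descends through the
  directional derivatives.\<close>

lemma higher_differentiable_on_SucD:
  "higher_differentiable_on S f (Suc k) \<Longrightarrow> higher_differentiable_on S f k"
proof (induction k arbitrary: f)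
  case 0
  then show ?case
    by (simp add: differentiable_imp_continuous_within continuous_at_imp_continuous_on)
next
  case (Suc k)
  from Suc.prems show ?case
    unfolding higher_differentiable_on.simps(2)[of S f]
    using Suc.IH by blast
qed

lemma higher_differentiable_on_const: "higher_differentiable_on S (\<lambda>x. c) k"
  by (induction k arbitrary: c) simp_all

lemma higher_differentiable_on_add:
  assumes "open S" "higher_differentiable_on S f k" "higher_differentiable_on S g k"
  shows "higher_differentiable_on S (\<lambda>x. f x + g x) k"
  using assms(2,3)
proof (induction k arbitrary: f g)
  case 0
  then show ?case by (simp add: continuous_on_add)
next
  case (Suc k)
  have D: "((\<lambda>x. f x + g x) has_derivative
      (\<lambda>v. frechet_derivative f (at x) v + frechet_derivative g (at x) v)) (at x)" if "x \<in> S" for x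
    using Suc.prems that by (intro has_derivative_add) (simp_all flip: frechet_derivative_works)
  have "higher_differentiable_on S (\<lambda>x. frechet_derivative (\<lambda>x. f x + g x) (at x) v) k" for v
  proof (rule higher_differentiable_on_cong[OF assms(1)])
    show "higher_differentiable_on S
        (\<lambda>x. frechet_derivative f (at x) v + frechet_derivative g (at x) v) k"
      using Suc.prems by (intro Suc.IH) simp_all
  qed (simp add: frechet_derivative_at[OF D, symmetric])
  with D show ?case by (auto simp: differentiable_def)
qed

lemma higher_differentiable_on_mult:
  fixes f g :: "'a::real_normed_vector \<Rightarrow> 'b::real_normed_algebra"
  assumes "open S" "higher_differentiable_on S f k" "higher_differentiable_on S g k"
  shows "higher_differentiable_on S (\<lambda>x. f x * g x) k"
  using assms(2,3)
proof (induction k arbitrary: f g)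
  case 0
  then show ?case by (simp add: continuous_on_mult)
next
  case (Suc k)
  have D: "((\<lambda>x. f x * g x) has_derivative
      (\<lambda>v. f x * frechet_derivative g (at x) v + frechet_derivative f (at x) v * g x)) (at x)"
    if "x \<in> S" for x
    using Suc.prems that by (intro has_derivative_mult) (simp_all flip: frechet_derivative_works)
  have "higher_differentiable_on S (\<lambda>x. frechet_derivative (\<lambda>x. f x * g x) (at x) v) k" for v
  proof (rule higher_differentiable_on_cong[OF assms(1)])
    show "higher_differentiable_on S
        (\<lambda>x. f x * frechet_derivative g (at x) v + frechet_derivative f (at x) v * g x) k"
      \<comment> \<open>In each product of the Leibniz rule one factor is undifferentiated, so it
        has to be lowered to order \<open>k\<close> before the induction hypothesis applies.\<close>
      using Suc.prems Suc.prems[THEN higher_differentiable_on_SucD]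
      by (intro higher_differentiable_on_add[OF assms(1)] Suc.IH) simp_all
  qed (simp add: frechet_derivative_at[OF D, symmetric])
  with D show ?case by (auto simp: differentiable_def)
qed

lemma smooth_manifold_open_image:
  "smooth_manifold A \<Longrightarrow> (U, \<phi>) \<in> A \<Longrightarrow> open (\<phi> ` U)"
  by (fastforce simp: smooth_manifold_def is_chart_def)

lemma smooth_functions_const: "(\<lambda>p. c) \<in> smooth_functions A"
  by (auto simp: smooth_functions_def smooth_on_def comp_def higher_differentiable_on_const)

lemma smooth_functions_add:
  assumes "smooth_manifold A" "f \<in> smooth_functions A" "h \<in> smooth_functions A"
  shows "(\<lambda>p. f p + h p) \<in> smooth_functions A"
  using assms
  by (fastforce simp: smooth_functions_def smooth_on_def comp_def
      intro: higher_differentiable_on_add smooth_manifold_open_image)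

lemma smooth_functions_mult:
  assumes "smooth_manifold A" "f \<in> smooth_functions A" "h \<in> smooth_functions A"
  shows "(\<lambda>p. f p * h p) \<in> smooth_functions A"
  using assms
  by (fastforce simp: smooth_functions_def smooth_on_def comp_def
      intro: higher_differentiable_on_mult smooth_manifold_open_image)

lemma smooth_functions_diff:
  assumes "smooth_manifold A" "f \<in> smooth_functions A" "h \<in> smooth_functions A"
  shows "(\<lambda>p. f p - h p) \<in> smooth_functions A"
  using smooth_functions_add[OF assms(1,2)
      smooth_functions_mult[OF assms(1) smooth_functions_const assms(3)], of "-1"]
  by simp


section \<open>Vector fields and the Lie bracket\<close>

lemma tangent_space_add:
  "v \<in> tangent_space A p \<Longrightarrow> f \<in> smooth_functions A \<Longrightarrow> h \<in> smooth_functions A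
    \<Longrightarrow> v (\<lambda>q. f q + h q) = v f + v h"
  by (simp add: tangent_space_def)

lemma tangent_space_scale:
  "v \<in> tangent_space A p \<Longrightarrow> f \<in> smooth_functions A \<Longrightarrow> v (\<lambda>q. c * f q) = c * v f"
  by (simp add: tangent_space_def)

lemma tangent_space_mult:
  "v \<in> tangent_space A p \<Longrightarrow> f \<in> smooth_functions A \<Longrightarrow> h \<in> smooth_functions A
    \<Longrightarrow> v (\<lambda>q. f q * h q) = f p * v h + h p * v f"
  by (simp add: tangent_space_def)

lemma tangent_space_not_smooth:
  "v \<in> tangent_space A p \<Longrightarrow> f \<notin> smooth_functions A \<Longrightarrow> v f = 0"
  by (simp add: tangent_space_def)

text \<open>Homogeneity with factor 0. It serves the bracket on non-smooth functions, where the
  inner derivative is the zero function.\<close>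

lemma tangent_space_zero_fun: "v \<in> tangent_space A p \<Longrightarrow> v (\<lambda>q. 0) = 0"
  using tangent_space_scale[OF _ smooth_functions_const, of v A p 0 0] by simp

lemma tangent_space_tscale: "v \<in> tangent_space A p \<Longrightarrow> tscale c v \<in> tangent_space A p"
  by (simp add: tangent_space_def tscale_def algebra_simps)

lemma tangent_space_diff:
  "v \<in> tangent_space A p \<Longrightarrow> w \<in> tangent_space A p \<Longrightarrow> v - w \<in> tangent_space A p"
  by (simp add: tangent_space_def algebra_simps)

lemma vector_fieldsD: "X \<in> vector_fields A \<Longrightarrow> X p \<in> tangent_space A p"
  by (simp add: vector_fields_def)

lemma vector_fields_deriv:
  "X \<in> vector_fields A \<Longrightarrow> f \<in> smooth_functions A \<Longrightarrow> field_deriv X f \<in> smooth_functions A"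
  by (simp add: vector_fields_def)

lemma vector_fields_diff:
  assumes "smooth_manifold A" "X \<in> vector_fields A" "Y \<in> vector_fields A"
  shows "X - Y \<in> vector_fields A"
  using assms smooth_functions_diff[OF assms(1)]
  by (simp add: vector_fields_def tangent_space_diff field_deriv_def)

text \<open>XY and YX each fail the Leibniz rule by the same mixed first-order terms, so their
  difference is again a derivation.\<close>

lemma lie_bracket_tangent:
  assumes M: "smooth_manifold A" and X: "X \<in> vector_fields A" and Y: "Y \<in> vector_fields A"
  shows "lie_bracket X Y p \<in> tangent_space A p"
proof -
  note add = tangent_space_add[OF vector_fieldsD] and scale = tangent_space_scale[OF vector_fieldsD]
    and mult = tangent_space_mult[OF vector_fieldsD]
  have add': "field_deriv Z (\<lambda>q. f q + h q) = (\<lambda>q. field_deriv Z f q + field_deriv Z h q)"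
    if "Z \<in> vector_fields A" "f \<in> smooth_functions A" "h \<in> smooth_functions A" for Z f h
    using that(2-) by (simp add: field_deriv_def add[OF that(1)])
  have scale': "field_deriv Z (\<lambda>q. c * f q) = (\<lambda>q. c * field_deriv Z f q)"
    if "Z \<in> vector_fields A" "f \<in> smooth_functions A" for Z f c
    using that(2-) by (simp add: field_deriv_def scale[OF that(1)])
  have mult': "field_deriv Z (\<lambda>q. f q * h q) = (\<lambda>q. f q * field_deriv Z h q + h q * field_deriv Z f q)"
    if "Z \<in> vector_fields A" "f \<in> smooth_functions A" "h \<in> smooth_functions A" for Z f h
    using that(2-) by (simp add: field_deriv_def mult[OF that(1)])
  \<comment> \<open>Leibniz rule applied twice. The terms Zh Wf + Zf Wh are symmetric in
    \<open>W\<close> and \<open>Z\<close>, hence drop out of the commutator.\<close>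
  have second: "W p (field_deriv Z (\<lambda>q. f q * h q)) =
      f p * W p (field_deriv Z h) + field_deriv Z h p * W p f
      + (h p * W p (field_deriv Z f) + field_deriv Z f p * W p h)"
    if W: "W \<in> vector_fields A" and Z: "Z \<in> vector_fields A"
      and fh: "f \<in> smooth_functions A" "h \<in> smooth_functions A" for W Z f h
    using fh vector_fields_deriv[OF Z fh(1)] vector_fields_deriv[OF Z fh(2)]
    by (simp add: mult'[OF Z] add[OF W] mult[OF W] smooth_functions_mult[OF M])
  \<comment> \<open>Yields the normalisation of the bracket to 0 on non-smooth functions.\<close>
  have zero: "field_deriv Z f = (\<lambda>q. 0)"
    if "Z \<in> vector_fields A" "f \<notin> smooth_functions A" for Z f
    using that(2) by (simp add: field_deriv_def tangent_space_not_smooth[OF vector_fieldsD[OF that(1)]])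
  \<comment> \<open>\<open>field_deriv\<close> stays folded at first, because \<open>add'\<close>,
    \<open>scale'\<close> and \<open>second\<close> match on it; unfolding it at the end lets the
    mixed terms cancel.\<close>
  show ?thesis
    unfolding tangent_space_def lie_bracket_def
    using X Y
    by (auto simp: add'[OF X] add'[OF Y] scale'[OF X] scale'[OF Y] add[OF X] add[OF Y]
        scale[OF X] scale[OF Y] second[OF X Y] second[OF Y X] zero[OF X] zero[OF Y]
        vector_fields_deriv[OF X] vector_fields_deriv[OF Y]
        tangent_space_zero_fun[OF vector_fieldsD[OF X]] tangent_space_zero_fun[OF vector_fieldsD[OF Y]]
        right_diff_distrib)
       (simp add: field_deriv_def algebra_simps)
qed

lemma lie_bracket_vector_field:
  assumes M: "smooth_manifold A" and X: "X \<in> vector_fields A" and Y: "Y \<in> vector_fields A"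
  shows "lie_bracket X Y \<in> vector_fields A"
proof -
  have "field_deriv (lie_bracket X Y) f
      = (\<lambda>p. field_deriv X (field_deriv Y f) p - field_deriv Y (field_deriv X f) p)" for f
    by (simp add: field_deriv_def lie_bracket_def)
  then show ?thesis
    using lie_bracket_tangent[OF M X Y] smooth_functions_diff[OF M] X Y
    unfolding vector_fields_def by simp
qed

lemma linear_connection_closed:
  "linear_connection A nabla \<Longrightarrow> X \<in> vector_fields A \<Longrightarrow> Y \<in> vector_fields A
    \<Longrightarrow> nabla X Y \<in> vector_fields A"
  by (simp add: linear_connection_def)


section \<open>Almost product structures\<close>

lemma almost_product_closed:
  "almost_product A E \<Longrightarrow> X \<in> vector_fields A \<Longrightarrow> endo_app E X \<in> vector_fields A"
  by (simp add: almost_product_def tangent_endomorphism_def)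

lemma almost_product_involution:
  "almost_product A E \<Longrightarrow> X \<in> vector_fields A \<Longrightarrow> endo_app E (endo_app E X) = X"
  by (simp add: almost_product_def endo_app_def vector_fieldsD)

lemma tangent_endomorphism_diff:
  assumes "tangent_endomorphism A E" "v \<in> tangent_space A p" "w \<in> tangent_space A p"
  shows "E p (v - w) = E p v - E p w"
proof -
  \<comment> \<open>Only sums and scalar multiples are covered by
    \<open>tangent_endomorphism\<close>, so a difference is turned into a sum with a
    (-1)-multiple.\<close>
  have neg: "u - x = u + tscale (-1) x" for u x :: "'a tangent"
    by (simp add: tscale_def fun_eq_iff)
  show ?thesis
    unfolding neg using assms by (simp add: tangent_endomorphism_def tangent_space_tscale)
qed

lemma endo_app_diff:
  assumes "tangent_endomorphism A E" "X \<in> vector_fields A" "Y \<in> vector_fields A"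
  shows "endo_app E (X - Y) = endo_app E X - endo_app E Y"
  using assms by (simp add: endo_app_def fun_eq_iff[of _ "_ - _"] tangent_endomorphism_diff vector_fieldsD)

text \<open>The zero field is written as \<open>X - X\<close>.\<close>

lemma endo_app_zero:
  assumes "tangent_endomorphism A E" "X \<in> vector_fields A"
  shows "endo_app E 0 = 0"
  using endo_app_diff[OF assms(1,2,2)] by simp

theorem proposition1p1:
  fixes A :: "('m::{t2_space, second_countable_topology}, 'e::real_normed_vector) chart set"
    and E :: "'m \<Rightarrow> 'm tangent \<Rightarrow> 'm tangent"
    and nabla :: "'m connection"
  assumes "smooth_manifold A"
    and "almost_product A E"
    and "linear_connection A nabla"
  shows
    "((\<forall>X\<in>vector_fields A. \<forall>Y\<in>vector_fields A.
        cov_deriv_endo (product_conjugate E nabla) E X Y = - cov_deriv_endo nabla E X Y)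
     \<and> (parallel_endo A nabla E \<longleftrightarrow> parallel_endo A (product_conjugate E nabla) E))
     \<and>
     (\<forall>X\<in>vector_fields A. \<forall>Y\<in>vector_fields A. product_conjugate E (product_conjugate E nabla) X Y = nabla X Y)
     \<and>
     ((\<forall>X\<in>vector_fields A. \<forall>Y\<in>vector_fields A.
        torsion (product_conjugate E nabla) X Y = torsion nabla X Y + endo_app E (ext_cov_deriv_endo nabla E X Y))
     \<and> (parallel_endo A nabla E \<longrightarrow>
          (\<forall>X\<in>vector_fields A. \<forall>Y\<in>vector_fields A. torsion nabla X Y = torsion (product_conjugate E nabla) X Y)))
     \<and>
     ((\<forall>X\<in>vector_fields A. \<forall>Y\<in>vector_fields A. \<forall>Z\<in>vector_fields A.
        curvature (product_conjugate E nabla) X Y Z = endo_app E (curvature nabla X Y (endo_app E Z)))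
     \<and> (flat A nabla \<longleftrightarrow> flat A (product_conjugate E nabla)))
     \<and>
     (\<forall>g. almost_product_riemannian A g E \<longrightarrow>
       (\<forall>X\<in>vector_fields A. \<forall>Y\<in>vector_fields A. \<forall>Z\<in>vector_fields A.
          cov_deriv_metric (product_conjugate E nabla) g X (endo_app E Y) (endo_app E Z) = cov_deriv_metric nabla g X Y Z)
       \<and> (metric_connection A nabla g \<longleftrightarrow> metric_connection A (product_conjugate E nabla) g))"
proof -
  note M = assms(1) and E = assms(2) and N = assms(3)
  let ?N = "product_conjugate E nabla"
  have TE: "tangent_endomorphism A E"
    using E by (simp add: almost_product_def)
  \<comment> \<open>Cancelling E^2 and distributing E over differences are conditional on membership
    in \<open>vector_fields A\<close>; these closure rules discharge the conditions
    automatically.\<close>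
  note [simp] = almost_product_closed[OF E] linear_connection_closed[OF N]
    vector_fields_diff[OF M] lie_bracket_vector_field[OF M]
  note [simp] = almost_product_involution[OF E] endo_app_diff[OF TE]

  \<comment> \<open>Both terms contain E^2; cancelling it leaves E(\<nabla>_X Y) -
    \<nabla>_X(EY).\<close>
  have dual_E: "cov_deriv_endo ?N E X Y = - cov_deriv_endo nabla E X Y"
    if "X \<in> vector_fields A" "Y \<in> vector_fields A" for X Y
    using that by (simp add: cov_deriv_endo_def product_conjugate_def)
  then have parallel: "parallel_endo A nabla E \<longleftrightarrow> parallel_endo A ?N E"
    by (simp add: parallel_endo_def)

  have dual: "product_conjugate E ?N X Y = nabla X Y"
    if "X \<in> vector_fields A" "Y \<in> vector_fields A" for X Y
    using that by (simp add: product_conjugate_def)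

  \<comment> \<open>E((\<nabla>_X E)Y) = E(\<nabla>_X(EY)) - \<nabla>_X Y is exactly the change of
    connection; antisymmetrising it leaves the bracket untouched.\<close>
  have torsion: "torsion ?N X Y = torsion nabla X Y + endo_app E (ext_cov_deriv_endo nabla E X Y)"
    if "X \<in> vector_fields A" "Y \<in> vector_fields A" for X Y
    using that
    by (simp add: torsion_def ext_cov_deriv_endo_def cov_deriv_endo_def product_conjugate_def)
  have torsion_parallel: "torsion nabla X Y = torsion ?N X Y"
    if "parallel_endo A nabla E" "X \<in> vector_fields A" "Y \<in> vector_fields A" for X Y
    using that endo_app_zero[OF TE that(2)]
    by (simp add: torsion ext_cov_deriv_endo_def parallel_endo_def)

  \<comment> \<open>In a second derivative the two inner copies of E meet and cancel, leaving
    E(\<nabla>_X \<nabla>_Y(EZ)); then E is pulled out of the whole difference.\<close>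
  have curv: "curvature ?N X Y Z = endo_app E (curvature nabla X Y (endo_app E Z))"
    if "X \<in> vector_fields A" "Y \<in> vector_fields A" "Z \<in> vector_fields A" for X Y Z
    using that by (simp add: curvature_def product_conjugate_def)
  \<comment> \<open>The mirror identity, reflecting duality: it carries flatness back from
    \<open>?N\<close> to \<open>nabla\<close>.\<close>
  have curv': "curvature nabla X Y Z = endo_app E (curvature ?N X Y (endo_app E Z))"
    if "X \<in> vector_fields A" "Y \<in> vector_fields A" "Z \<in> vector_fields A" for X Y Z
    using that by (simp add: curvature_def product_conjugate_def)
  have flat: "flat A nabla \<longleftrightarrow> flat A ?N"
  proof
    assume "flat A nabla"
    then show "flat A ?N"
      unfolding flat_def using endo_app_zero[OF TE] by (simp add: curv)
  next
    assume "flat A ?N"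
    then show "flat A nabla"
      unfolding flat_def using endo_app_zero[OF TE] by (simp add: curv')
  qed

  \<comment> \<open>Since \<nabla>^(E)_X(EY) = E(\<nabla>_X Y), every entry of \<open>g\<close>
    carries an E, and the isometry property removes them in pairs.\<close>
  have metric: "cov_deriv_metric ?N g X (endo_app E Y) (endo_app E Z) = cov_deriv_metric nabla g X Y Z"
    if "almost_product_riemannian A g E"
      "X \<in> vector_fields A" "Y \<in> vector_fields A" "Z \<in> vector_fields A" for g X Y Z
    using that
    by (simp add: cov_deriv_metric_def product_conjugate_def almost_product_riemannian_def)
  have metric_iff: "metric_connection A nabla g \<longleftrightarrow> metric_connection A ?N g"
    if g: "almost_product_riemannian A g E" for g
  proof
    assume "metric_connection A ?N g"
    then show "metric_connection A nabla g"
      unfolding metric_connection_def by (simp add: metric[OF g, symmetric])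
  next
    assume nabla: "metric_connection A nabla g"
    \<comment> \<open>The identity \<open>metric\<close> speaks only of arguments of the form EY,
      EZ. Every field has this form, as Y = E(EY), so it is instantiated at EY and EZ.\<close>
    have "cov_deriv_metric ?N g X Y Z = 0"
      if "X \<in> vector_fields A" "Y \<in> vector_fields A" "Z \<in> vector_fields A" for X Y Z
      using nabla metric[OF g, of X "endo_app E Y" "endo_app E Z"] that
      by (simp add: metric_connection_def)
    then show "metric_connection A ?N g"
      by (simp add: metric_connection_def)
  qed

  show ?thesis
    by (intro conjI ballI allI impI;
        rule dual_E parallel dual torsion torsion_parallel curv flat metric metric_iff; assumption)
qed

end
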